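(* For every $n\ge 1$, $$T_n(x)=(1-x^n)\varphi(n)\sum_{d\mid n}\frac{\mu^2(d)\,f_d(n/d)}{\varphi(d)\,(1-x^{n/d})},$$ where $T_n(x)=\sum_{k=0}^{n-1}|c_n(k)|x^k$ and, for positive integers $k,m$, $f_k(m)=\prod_{p\mid m,\ p\nmid k}\big(1-\frac{1}{p-1}\big)$ (product over primes $p$).
   Context: For integers $n\ge 1$ and $k$, the Ramanujan sum $c_n(k)$ is the sum of the $k$th powers of the primitive $n$th roots of unity, i.e. $c_n(k)=\sum_{1\le j\le n,\ \gcd(j,n)=1} e^{2\pi \sqrt{-1}\, jk/n}$. $\varphi$ is Euler's function and $\mu$ the Möbius function. The identity is one of rational functions (equivalently, of polynomials after clearing denominators). *)

theory Defs
  imports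
    Complex_Main
    "HOL-Computational_Algebra.Computational_Algebra"
    "HOL-Number_Theory.Totient"
begin

definition ramanujan_sum :: "nat \<Rightarrow> int \<Rightarrow> complex" where
  "ramanujan_sum n k =
     (\<Sum>j | 1 \<le> j \<and> j \<le> n \<and> gcd j n = 1.
        exp (2 * complex_of_real pi * \<i> * of_nat j * of_int k / of_nat n))"

definition moebius_mu :: "nat \<Rightarrow> int" where
  "moebius_mu n = (if squarefree n then (- 1) ^ card (prime_factors n) else 0)"

definition T_poly :: "nat \<Rightarrow> real poly" where
  "T_poly n = (\<Sum>k<n. monom (cmod (ramanujan_sum n (int k))) k)"

definition f_prod :: "nat \<Rightarrow> nat \<Rightarrow> real" where
  "f_prod k m = (\<Prod>p | prime p \<and> p dvd m \<and> \<not> p dvd k. 1 - 1 / (real p - 1))"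

text \<open>Rational functions over the reals form the fraction field \<^typ>\<open>real poly fract\<close>;
  \<open>ratX\<close> is its indeterminate and \<open>ratC\<close> the embedding of the constants.\<close>

definition ratX :: "real poly fract" where
  "ratX = to_fract [:0, 1:]"

definition ratC :: "real \<Rightarrow> real poly fract" where
  "ratC c = to_fract [:c:]"

end

theory Submission
  imports Defs
begin

text \<open>
  Hoelder's evaluation \<open>c\<^sub>n(k) = \<mu>(m) \<phi>(n) / \<phi>(m)\<close> with \<open>m = n / gcd(n, k)\<close> gives
  \<open>\<bar>c\<^sub>n(k)\<bar> = \<phi>(n) \<mu>\<^sup>2(m) / \<phi>(m)\<close>. On the other side, \<open>(1 - x\<^sup>n) / (1 - x\<^bsup>n/d\<^esup>)\<close> is the sum of the
  \<open>x\<^sup>k\<close> with \<open>k < n\<close> and \<open>n/d\<close> dividing \<open>k\<close>, and for \<open>d\<close> dividing \<open>n\<close> this divisibility means that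
  \<open>m\<close> divides \<open>d\<close>. So comparing coefficients leaves
  \<open>\<Sum>\<^bsub>m | d | n\<^esub> \<mu>\<^sup>2(d) f\<^sub>d(n/d) / \<phi>(d) = \<mu>\<^sup>2(m) / \<phi>(m)\<close>. For squarefree \<open>m\<close> the sum expands the
  product over the primes \<open>p | n\<close> of \<open>1/(p-1)\<close> if \<open>p | m\<close> and of
  \<open>1/(p-1) + (1 - 1/(p-1)) = 1\<close> otherwise.

  Hoelder's formula follows by computing \<open>\<Sum> e(u j k / n)\<close>, over units \<open>u\<close> mod \<open>m\<close> and
  \<open>j\<close> mod \<open>n\<close>, in both orders: the sum over \<open>u\<close> is \<open>c\<^sub>m(1) = \<mu>(m)\<close>, and the sum over \<open>j\<close> is
  \<open>c\<^sub>n(k)\<close> since \<open>u\<close> lifts to a unit mod \<open>n\<close>.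
\<close>

section \<open>Sums over squarefree divisors\<close>

text \<open>The maps \<open>prime_factors\<close> and \<open>Prod\<close> are mutually inverse
  between the squarefree divisors of \<open>n\<close> and the subsets of
  \<open>prime_factors n\<close>, so the sum is the expansion of the product over subsets.\<close>

lemma sum_squarefree_divisors:
  fixes a b :: "nat \<Rightarrow> 'a :: comm_ring_1"
  assumes "n > 0"
  shows "(\<Sum>d | d dvd n \<and> squarefree d.
            (\<Prod>p\<in>prime_factors d. a p) * (\<Prod>p\<in>prime_factors n - prime_factors d. b p)) =
         (\<Prod>p\<in>prime_factors n. a p + b p)"
proof -
  have prime_factors_Prod: "prime_factors (\<Prod>X) = X" if "X \<subseteq> prime_factors n" for X
  proof -
    have "finite X" using that finite_subset by blast
    moreover have "\<forall>p\<in>X. prime p" using that by auto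
    ultimately show ?thesis by (subst prime_factors_prod) (auto simp: prime_factorization_prime)
  qed
  have dvd: "\<Prod>X dvd n" if "X \<subseteq> prime_factors n" for X
  proof -
    have "\<Prod>X dvd \<Prod>(prime_factors n)" using that by (intro prod_dvd_prod_subset) auto
    also have "\<dots> dvd (\<Prod>p\<in>prime_factors n. p ^ multiplicity p n)"
      by (intro prod_dvd_prod) (auto simp: prime_factors_multiplicity intro: dvd_power)
    also have "\<dots> = n" using prime_factorization_nat[OF assms] by simp
    finally show ?thesis .
  qed
  have sqf: "squarefree (\<Prod>X)" if "X \<subseteq> prime_factors n" for X
    using that by (intro squarefree_prod_coprime)
      (auto intro!: squarefree_prime primes_coprime)
  have Prod_prime_factors: "\<Prod>(prime_factors d) = d" if "squarefree d" for d :: nat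
  proof -
    have "d \<noteq> 0" using that by (intro notI) simp
    hence "d = (\<Prod>p\<in>prime_factors d. p ^ multiplicity p d)"
      using prime_factorization_nat[of d] by simp
    also have "\<dots> = \<Prod>(prime_factors d)"
      using that \<open>d \<noteq> 0\<close> by (intro prod.cong) (auto simp: squarefree_factorial_semiring')
    finally show ?thesis by simp
  qed
  have "(\<Prod>p\<in>prime_factors n. a p + b p) =
        (\<Sum>X\<in>Pow (prime_factors n). (\<Prod>p\<in>X. a p) * (\<Prod>p\<in>prime_factors n - X. b p))"
    by (rule prod_add) auto
  also have "\<dots> = (\<Sum>d | d dvd n \<and> squarefree d.
            (\<Prod>p\<in>prime_factors d. a p) * (\<Prod>p\<in>prime_factors n - prime_factors d. b p))"
    by (rule sum.reindex_bij_witness[where i = prime_factors and j = Prod])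
       (use assms in \<open>auto simp: prime_factors_Prod Prod_prime_factors dvd sqf
          intro: dvd_prime_factors[THEN subsetD]\<close>)
  finally show ?thesis by simp
qed

text \<open>With \<open>a = -1\<close> and \<open>b = 1\<close> every factor
  \<open>a p + b p\<close> is 0, so the product vanishes unless \<open>n\<close> has no prime
  factor.\<close>

lemma sum_moebius_divisors:
  assumes "n > 0"
  shows "(\<Sum>d | d dvd n. moebius_mu d) = (if n = 1 then 1 else 0)"
proof -
  have "(\<Sum>d | d dvd n. moebius_mu d) = (\<Sum>d | d dvd n \<and> squarefree d. moebius_mu d)"
    using assms by (intro sum.mono_neutral_right) (auto simp: moebius_mu_def)
  also have "\<dots> = (\<Sum>d | d dvd n \<and> squarefree d. (\<Prod>p\<in>prime_factors d. -1) *
                     (\<Prod>p\<in>prime_factors n - prime_factors d. 1))"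
    by (intro sum.cong) (auto simp: moebius_mu_def)
  also have "\<dots> = (\<Prod>p\<in>prime_factors n. -1 + 1)"
    by (rule sum_squarefree_divisors[OF assms])
  also have "\<dots> = (if n = 1 then 1 else 0)"
    using assms by (auto simp: card_gt_0_iff prime_factorization_empty_iff)
  finally show ?thesis .
qed

lemma totient_squarefree:
  assumes "squarefree d"
  shows "real (totient d) = (\<Prod>p\<in>prime_factors d. real p - 1)"
proof -
  have "d \<noteq> 0" using assms by (intro notI) simp
  hence "totient d = (\<Prod>p\<in>prime_factors d. p ^ (multiplicity p d - 1) * (p - 1))"
    by (intro totient_formula1) simp
  also have "\<dots> = (\<Prod>p\<in>prime_factors d. p - 1)"
    using assms \<open>d \<noteq> 0\<close> by (intro prod.cong) (auto simp: squarefree_factorial_semiring')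
  finally show ?thesis
    using prime_ge_1_nat by (auto simp: of_nat_diff in_prime_factors_iff intro!: prod.cong)
qed

lemma sum_f_prod_multiples:
  assumes "n > 0" "m dvd n"
  shows "(\<Sum>d | d dvd n \<and> m dvd d.
            (real_of_int (moebius_mu d))\<^sup>2 * f_prod d (n div d) / totient d) =
         (real_of_int (moebius_mu m))\<^sup>2 / totient m"
proof (cases "squarefree m")
  case False
  have "moebius_mu d = 0" if "m dvd d" for d
    using False that squarefree_mono by (auto simp: moebius_mu_def)
  thus ?thesis by (auto intro!: sum.neutral)
next
  case True
  define a where "a = (\<lambda>p. 1 / (real p - 1))"
  \<comment> \<open>\<open>b\<close> vanishes at the primes of \<open>m\<close>, which removes the divisors \<open>d\<close> that \<open>m\<close> does not divide.\<close>
  define b where "b = (\<lambda>p. if p dvd m then 0 else 1 - a p)"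
  have m: "m > 0" using assms by (auto intro: Nat.gr0I)
  \<comment> \<open>Since \<open>n = d * (n div d)\<close>, a prime not dividing \<open>d\<close>
    divides \<open>n div d\<close> iff it divides \<open>n\<close>. This turns \<open>f_prod\<close>
    into a product over the complement used in \<open>sum_squarefree_divisors\<close>.\<close>
  have f_prod: "f_prod d (n div d) = (\<Prod>p\<in>prime_factors n - prime_factors d. 1 - a p)"
    if "d dvd n" for d
  proof -
    have "{p. prime p \<and> p dvd n div d \<and> \<not> p dvd d} = prime_factors n - prime_factors d"
    proof -
      from that obtain e where e: "n = d * e" by (elim dvdE)
      with assms(1) have "d > 0" "e > 0" by (auto intro: Nat.gr0I)
      thus ?thesis by (auto simp: e prime_factors_dvd prime_dvd_mult_iff)
    qed
    thus ?thesis by (simp add: f_prod_def a_def)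
  qed
  have mu: "(real_of_int (moebius_mu d))\<^sup>2 = (if squarefree d then 1 else 0)" for d
    by (auto simp: moebius_mu_def simp flip: power_mult)
  have tot: "1 / real (totient d) = (\<Prod>p\<in>prime_factors d. a p)" if "squarefree d" for d
    using totient_squarefree[OF that] by (simp add: a_def prod_dividef)
  \<comment> \<open>Squarefreeness of \<open>m\<close> bounds its multiplicities by 1, so inclusion
    of the prime sets is enough for divisibility.\<close>
  have dvd_iff: "m dvd d \<longleftrightarrow> prime_factors m \<subseteq> prime_factors d" if "d > 0" for d
  proof
    assume subset: "prime_factors m \<subseteq> prime_factors d"
    show "m dvd d"
    proof (rule multiplicity_le_imp_dvd)
      fix p :: nat assume "prime p"
      have "multiplicity p m \<le> 1"
        using True m \<open>prime p\<close> by (simp add: squarefree_factorial_semiring'')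
      moreover have "multiplicity p m > 0 \<longrightarrow> multiplicity p d > 0"
        using subset \<open>prime p\<close> by (auto simp: prime_factors_multiplicity)
      ultimately show "multiplicity p m \<le> multiplicity p d" by linarith
    qed (use m in simp)
  qed (use that in \<open>auto intro: dvd_prime_factors[THEN subsetD]\<close>)
  have "(\<Sum>d | d dvd n \<and> m dvd d. (real_of_int (moebius_mu d))\<^sup>2 * f_prod d (n div d) / totient d) =
        (\<Sum>d | d dvd n \<and> squarefree d.
            (\<Prod>p\<in>prime_factors d. a p) * (\<Prod>p\<in>prime_factors n - prime_factors d. b p))"
  \<comment> \<open>Neither index set contains the other: the squarefree \<open>d\<close> outside
    the left one have a factor \<open>b p = 0\<close>, and the \<open>d\<close> outside the right
    one are not squarefree and have \<open>moebius_mu d = 0\<close>.\<close>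
  proof (rule sum.mono_neutral_cong)
    fix d assume "d \<in> {d. d dvd n \<and> squarefree d} - {d. d dvd n \<and> m dvd d}"
    hence d: "d dvd n" "squarefree d" "\<not> m dvd d" by auto
    hence "d > 0" using assms by (auto intro: Nat.gr0I)
    then obtain p where "p \<in> prime_factors m" "p \<notin> prime_factors d"
      using d dvd_iff by auto
    hence "p \<in> prime_factors n - prime_factors d" "b p = 0"
      using assms m by (auto simp: b_def prime_factors_dvd)
    hence "(\<Prod>p\<in>prime_factors n - prime_factors d. b p) = 0"
      by (intro prod_zero) auto
    thus "(\<Prod>p\<in>prime_factors d. a p) * (\<Prod>p\<in>prime_factors n - prime_factors d. b p) = 0" by simp
  next
    fix d assume "d \<in> {d. d dvd n \<and> m dvd d} \<inter> {d. d dvd n \<and> squarefree d}"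
    hence d: "d dvd n" "m dvd d" "squarefree d" by auto
    hence "d > 0" using assms by (auto intro: Nat.gr0I)
    have "(\<Prod>p\<in>prime_factors n - prime_factors d. b p) =
          (\<Prod>p\<in>prime_factors n - prime_factors d. 1 - a p)"
      using d \<open>d > 0\<close> by (intro prod.cong) (auto simp: b_def prime_factors_dvd)
    thus "(real_of_int (moebius_mu d))\<^sup>2 * f_prod d (n div d) / totient d =
       (\<Prod>p\<in>prime_factors d. a p) * (\<Prod>p\<in>prime_factors n - prime_factors d. b p)"
      using d f_prod[OF d(1)] by (simp add: mu flip: tot)
  qed (use assms in \<open>auto simp: mu\<close>)
  also have "\<dots> = (\<Prod>p\<in>prime_factors n. a p + b p)"
    by (rule sum_squarefree_divisors) fact
  also have "\<dots> = (\<Prod>p\<in>prime_factors m. a p)"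
    using assms m by (intro prod.mono_neutral_cong_right)
      (auto simp: b_def prime_factors_dvd intro: dvd_trans)
  also have "\<dots> = (real_of_int (moebius_mu m))\<^sup>2 / totient m"
    using True by (simp add: mu flip: tot)
  finally show ?thesis .
qed

section \<open>Roots of unity and the value c_n(1)\<close>

definition unity_root :: "nat \<Rightarrow> complex" where
  "unity_root n = cis (2 * pi / real n)"

lemma unity_root_power_self [simp]: "n > 0 \<Longrightarrow> unity_root n ^ n = 1"
  by (simp add: unity_root_def DeMoivre)

lemma unity_root_power_mod:
  assumes "n > 0"
  shows "unity_root n ^ (k mod n) = unity_root n ^ k"
proof -
  have "unity_root n ^ k = unity_root n ^ (n * (k div n) + k mod n)" by simp
  also have "\<dots> = (unity_root n ^ n) ^ (k div n) * unity_root n ^ (k mod n)"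
    by (simp only: power_add power_mult)
  finally show ?thesis using assms by simp
qed

lemma unity_root_power_cancel: "d > 0 \<Longrightarrow> unity_root (d * m) ^ (d * j) = unity_root m ^ j"
  by (simp add: unity_root_def DeMoivre)

lemma sum_unity_root_powers:
  assumes "n > 0"
  shows "(\<Sum>j\<in>{0<..n}. unity_root n ^ j) = (if n = 1 then 1 else 0)"
proof (cases "n = 1")
  case False
  \<comment> \<open>Exponent \<open>n\<close> is moved to 0, where the power is also 1; what results
    is a geometric sum.\<close>
  have "(\<Sum>j\<in>{0<..n}. unity_root n ^ j) = (\<Sum>j<n. unity_root n ^ j)"
    using assms by (intro sum.reindex_bij_witness[where i = "\<lambda>j. if j = 0 then n else j"
        and j = "\<lambda>j. j mod n"]) (auto simp: unity_root_power_mod le_less)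
  also have "\<dots> = 0"
  proof -
    have "unity_root n \<noteq> 1"
    proof
      assume "unity_root n = 1"
      with assms obtain k :: int where "2 * pi / real n = 2 * pi * of_int k"
        by (auto simp: unity_root_def complex_eq_iff cos_one_2pi_int)
      with assms have "of_int (int n * k) = (of_int 1 :: real)" by (simp add: field_simps)
      hence "int n * k = 1" by (subst (asm) of_int_eq_iff)
      thus False using False by (auto simp: zmult_eq_1_iff)
    qed
    thus ?thesis using assms by (subst geometric_sum) auto
  qed
  finally show ?thesis using False by simp
qed (use unity_root_power_self[of 1] in \<open>auto simp: greaterThanAtMost_eq_atLeastAtMost_diff\<close>)

text \<open>Grouping all powers by \<open>gcd j n\<close> shows that these sums and
  \<open>moebius_mu\<close> have the same divisor sums. By strong induction the terms at proper
  divisors agree, which leaves the term at \<open>n\<close>.\<close>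

lemma sum_primitive_unity_roots:
  assumes "n > 0"
  shows "(\<Sum>j\<in>totatives n. unity_root n ^ j) = of_int (moebius_mu n)"
  using assms
proof (induction n rule: less_induct)
  case (less n)
  let ?S = "\<lambda>n. \<Sum>j\<in>totatives n. unity_root n ^ j"
  define A where "A = (\<lambda>d. {k\<in>{0<..n}. gcd k n = d})"
  \<comment> \<open>The \<open>j\<close> with gcd \<open>d\<close> are \<open>d\<close> times the
    totatives of \<open>n div d\<close>, and \<open>d\<close> cancels against the order of the
    root.\<close>
  have A: "(\<Sum>j\<in>A d. unity_root n ^ j) = ?S (n div d)" if d: "d dvd n" for d
  proof -
    have "d > 0" using d less.prems by (auto intro: Nat.gr0I)
    have "(\<Sum>j\<in>A d. unity_root n ^ j) = (\<Sum>j\<in>totatives (n div d). unity_root n ^ (j * d))"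
      unfolding A_def
      by (rule sum.reindex_bij_betw[OF bij_betw_totatives_gcd_eq, symmetric]) (use d less.prems in auto)
    also have "\<dots> = ?S (n div d)"
      using d \<open>d > 0\<close> unity_root_power_cancel[of d "n div d"]
      by (intro sum.cong) (auto simp: mult.commute)
    finally show ?thesis .
  qed
  have "of_int (\<Sum>d | d dvd n. moebius_mu d) = (\<Sum>j\<in>{0<..n}. unity_root n ^ j)"
    using less.prems by (simp add: sum_moebius_divisors sum_unity_root_powers)
  also have "{0<..n} = (\<Union>d\<in>{d. d dvd n}. A d)" by (auto simp: A_def)
  also have "(\<Sum>j\<in>\<dots>. unity_root n ^ j) = (\<Sum>d | d dvd n. \<Sum>j\<in>A d. unity_root n ^ j)"
    using less.prems by (intro sum.UNION_disjoint) (auto simp: A_def)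
  also have "\<dots> = (\<Sum>d | d dvd n. ?S (n div d))" by (rule sum.cong) (auto simp: A)
  also have "\<dots> = (\<Sum>d | d dvd n. ?S d)"
    by (rule sum.reindex_bij_witness[of _ "(div) n" "(div) n"])
       (use less.prems in \<open>auto elim: dvdE\<close>)
  finally have "(\<Sum>d | d dvd n. ?S d) = (\<Sum>d | d dvd n. of_int (moebius_mu d))" by simp
  moreover have "(\<Sum>d\<in>{d. d dvd n} - {n}. ?S d) = (\<Sum>d\<in>{d. d dvd n} - {n}. of_int (moebius_mu d))"
    using less.prems by (intro sum.cong refl less.IH) (auto intro: Nat.gr0I dest: dvd_imp_le)
  ultimately show ?case
    using less.prems by (simp add: sum.remove[of "{d. d dvd n}" n])
qed

section \<open>Hoelder's formula\<close>

lemma sum_totatives_mult: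
  fixes F :: "nat \<Rightarrow> 'a :: comm_monoid_add"
  assumes "coprime a n" "\<And>j. F (j mod n) = F j"
  shows "(\<Sum>j\<in>totatives n. F (a * j)) = (\<Sum>j\<in>totatives n. F j)"
\<comment> \<open>The map \<open>j \<mapsto> a * j mod n\<close> permutes the totatives only for
  \<open>n > 1\<close>: the single totative of 1 is 1, but reduction mod 1 gives 0.\<close>
proof (cases "n \<le> 1")
  case True
  hence "n = 0 \<or> n = 1" by auto
  thus ?thesis using assms(2)[of a] assms(2)[of 1] by auto
next
  case False
  hence n: "n > 1" by simp
  have maps: "a * j mod n \<in> totatives n" if "j \<in> totatives n" for j
  proof -
    have "coprime (a * j mod n) n" using that assms(1) by (simp add: in_totatives_iff)
    moreover from this have "a * j mod n \<noteq> 0" using n by (intro notI) simp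
    ultimately show ?thesis using n by (simp add: in_totatives_iff less_imp_le)
  qed
  have inj: "inj_on (\<lambda>j. a * j mod n) (totatives n)"
  proof (rule inj_onI)
    fix i j assume ij: "i \<in> totatives n" "j \<in> totatives n" "a * i mod n = a * j mod n"
    hence "[a * i = a * j] (mod n)" by (simp add: cong_def)
    hence "[i = j] (mod n)" using assms(1) by (simp add: cong_mult_lcancel_nat)
    thus "i = j" using ij totatives_less n by (auto simp: cong_def)
  qed
  have "bij_betw (\<lambda>j. a * j mod n) (totatives n) (totatives n)"
    unfolding bij_betw_def using inj maps by (intro conjI endo_inj_surj) auto
  from sum.reindex_bij_betw[OF this, of F] show ?thesis by (simp add: assms(2))
qed

text \<open>The witness is \<open>r + m * q\<close>, with \<open>q\<close> the product of the primes
  of \<open>n\<close> not dividing \<open>r\<close>. Every prime of \<open>n\<close> then divides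
  exactly one of \<open>r\<close> and \<open>m * q\<close>, hence not their sum.\<close>

lemma coprime_lift:
  fixes r m n :: nat
  assumes "n > 0" "coprime r m"
  obtains a where "a mod m = r mod m" "coprime a n"
proof
  define q where "q = (\<Prod>p | p \<in> prime_factors n \<and> \<not> p dvd r. p)"
  show "(r + m * q) mod m = r mod m" by simp
  show "coprime (r + m * q) n"
  proof (rule ccontr)
    assume "\<not> coprime (r + m * q) n"
    then obtain p where p: "prime p" "p dvd r + m * q" "p dvd n"
      by (metis coprime_iff_gcd_eq_1 gcd_greatest_iff prime_factor_nat)
    have q: "p dvd q \<longleftrightarrow> \<not> p dvd r"
    proof
      assume "p dvd q"
      then obtain p' where "p' \<in> prime_factors n" "\<not> p' dvd r" "p dvd p'"
        unfolding q_def using p(1) by (subst (asm) prime_dvd_prod_iff) auto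
      thus "\<not> p dvd r" using p(1) primes_dvd_imp_eq[of p p'] by auto
    next
      assume "\<not> p dvd r"
      thus "p dvd q" unfolding q_def using p assms
        by (intro dvd_prodI) (auto simp: prime_factors_dvd)
    qed
    show False
    proof (cases "p dvd r")
      case True
      hence "p dvd m * q" using p(2) by (simp add: dvd_add_right_iff)
      hence "p dvd m" using q True p(1) by (auto simp: prime_dvd_mult_iff)
      with True show False using assms(2) p(1) coprime_common_divisor_nat not_prime_1 by blast
    next
      case False
      hence "p dvd m * q" using q by simp
      hence "p dvd r" using p(2) by (simp add: dvd_add_left_iff)
      with False show False by simp
    qed
  qed
qed

lemma ramanujan_sum_eq:
  "n > 0 \<Longrightarrow> ramanujan_sum n (int k) = (\<Sum>j\<in>totatives n. unity_root n ^ (j * k))"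
  unfolding ramanujan_sum_def
  by (intro sum.cong)
     (auto simp: totatives_def unity_root_def DeMoivre cis_conv_exp coprime_iff_gcd_eq_1 mult_ac
        simp flip: exp_of_nat_mult)

lemma ramanujan_sum_hoelder:
  assumes "n > 0" "m = n div gcd n k"
  shows "ramanujan_sum n (int k) * totient m = of_int (moebius_mu m) * totient n"
proof -
  define g where "g = gcd n k"
  have "g > 0" using assms by (simp add: g_def)
  have n: "n = g * m" by (simp add: g_def assms)
  define k' where "k' = k div g"
  have k: "k = g * k'" by (simp add: g_def k'_def)
  have "m > 0" using n assms by (auto intro: Nat.gr0I)
  have "coprime k' m"
    using assms div_gcd_coprime[of n k] by (auto simp: k'_def g_def coprime_commute)
  let ?z = "unity_root m"
  have c: "ramanujan_sum n (int k) = (\<Sum>j\<in>totatives n. ?z ^ (j * k'))"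
    unfolding ramanujan_sum_eq[OF assms(1)]
    by (intro sum.cong refl)
       (simp add: n k unity_root_power_cancel[OF \<open>g > 0\<close>] mult.left_commute[of _ g])
  have period: "?z ^ (i * l) = ?z ^ (j * l)" if "i mod m = j mod m" for i j l
    using that \<open>m > 0\<close> unity_root_power_mod by (metis mod_mult_left_eq)
  have "(\<Sum>u\<in>totatives m. \<Sum>j\<in>totatives n. ?z ^ (u * (j * k'))) =
        (\<Sum>u\<in>totatives m. ramanujan_sum n (int k))"
  proof (intro sum.cong refl)
    fix u assume "u \<in> totatives m"
    hence "coprime u m" by (simp add: in_totatives_iff)
    then obtain a where a: "a mod m = u mod m" "coprime a n"
      using coprime_lift assms(1) by blast
    have "(\<Sum>j\<in>totatives n. ?z ^ (u * (j * k'))) = (\<Sum>j\<in>totatives n. ?z ^ (a * j * k'))"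
      using period[OF a(1)] by (simp add: mult.assoc)
    also have "\<dots> = (\<Sum>j\<in>totatives n. ?z ^ (j * k'))"
      \<comment> \<open>The summand has period \<open>m\<close> in \<open>j\<close>, hence also
        period \<open>n\<close>, because \<open>m\<close> divides \<open>n\<close>.\<close>
      using a(2) by (intro sum_totatives_mult) (auto intro!: period simp: n mod_mod_cancel)
    finally show "(\<Sum>j\<in>totatives n. ?z ^ (u * (j * k'))) = ramanujan_sum n (int k)"
      by (simp add: c)
  qed
  moreover have "(\<Sum>j\<in>totatives n. \<Sum>u\<in>totatives m. ?z ^ (u * (j * k'))) =
        (\<Sum>j\<in>totatives n. of_int (moebius_mu m))"
  proof (intro sum.cong refl)
    fix j assume "j \<in> totatives n"
    \<comment> \<open>As \<open>j * k'\<close> is a unit mod \<open>m\<close>, multiplying by it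
      permutes the primitive \<open>m\<close>th roots of unity.\<close>
    hence "coprime (j * k') m" using \<open>coprime k' m\<close> by (auto simp: in_totatives_iff n)
    hence "(\<Sum>u\<in>totatives m. ?z ^ (j * k' * u)) = (\<Sum>u\<in>totatives m. ?z ^ u)"
      using \<open>m > 0\<close> by (intro sum_totatives_mult) (auto simp: unity_root_power_mod)
    thus "(\<Sum>u\<in>totatives m. ?z ^ (u * (j * k'))) = of_int (moebius_mu m)"
      using \<open>m > 0\<close> by (simp add: sum_primitive_unity_roots mult_ac)
  qed
  ultimately show ?thesis
    by (subst (asm) sum.swap) (simp add: totient_def mult_ac)
qed

section \<open>The coefficients of T_n\<close>

lemma norm_ramanujan_sum:
  assumes "n > 0" "m = n div gcd n k"
  shows "cmod (ramanujan_sum n (int k)) = totient n * ((real_of_int (moebius_mu m))\<^sup>2 / totient m)"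
proof -
  have "m > 0" using assms by (auto simp: div_greater_zero_iff intro!: gcd_le1_nat)
  have "cmod (ramanujan_sum n (int k)) * totient m = \<bar>real_of_int (moebius_mu m)\<bar> * totient n"
    using arg_cong[OF ramanujan_sum_hoelder[OF assms], of cmod] by (simp add: norm_mult)
  moreover have "\<bar>real_of_int (moebius_mu m)\<bar> = (real_of_int (moebius_mu m))\<^sup>2"
    by (auto simp: moebius_mu_def power_abs simp flip: power_mult)
  ultimately show ?thesis using \<open>m > 0\<close> by (simp add: field_simps)
qed

text \<open>The right side is the coefficient of x^k in the claimed formula once each quotient (1 -
  x^n) / (1 - x^(n/d)) is written as a polynomial.\<close>

lemma norm_ramanujan_sum_eq_sum:
  assumes "n > 0"
  shows "cmod (ramanujan_sum n (int k)) = (\<Sum>d | d dvd n. if n div d dvd k then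
           totient n * ((real_of_int (moebius_mu d))\<^sup>2 * f_prod d (n div d) / totient d) else 0)"
proof -
  define m where "m = n div gcd n k"
  have n: "n = gcd n k * m" by (simp add: m_def)
  have m: "m dvd n" using n by (metis dvd_triv_right)
  \<comment> \<open>Writing \<open>n = d * e = gcd n k * m\<close>, multiply
    \<open>e dvd gcd n k\<close> by \<open>m\<close> to get \<open>e * m dvd e * d\<close>, then
    cancel \<open>e\<close>.\<close>
  have iff: "n div d dvd k \<longleftrightarrow> m dvd d" if "d dvd n" for d
  proof -
    from that obtain e where e: "n = d * e" by auto
    have "d > 0" "e > 0" using e assms by (auto intro: Nat.gr0I)
    have "n div d dvd k \<longleftrightarrow> e dvd gcd n k" using e \<open>d > 0\<close> by simp
    also have "\<dots> \<longleftrightarrow> m dvd d"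
    proof -
      have "e dvd gcd n k \<longleftrightarrow> e * m dvd gcd n k * m"
        using n assms by (subst dvd_times_right_cancel_iff) (auto intro: Nat.gr0I)
      also have "gcd n k * m = e * d" using n e by (simp add: mult.commute)
      also have "e * m dvd e * d \<longleftrightarrow> m dvd d" using \<open>e > 0\<close> by simp
      finally show ?thesis .
    qed
    finally show ?thesis .
  qed
  have "cmod (ramanujan_sum n (int k)) = totient n *
      (\<Sum>d | d dvd n \<and> m dvd d. (real_of_int (moebius_mu d))\<^sup>2 * f_prod d (n div d) / totient d)"
    using norm_ramanujan_sum[OF assms m_def] sum_f_prod_multiples[OF assms m] by simp
  also have "\<dots> = (\<Sum>d | d dvd n. if n div d dvd k then
           totient n * ((real_of_int (moebius_mu d))\<^sup>2 * f_prod d (n div d) / totient d) else 0)"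
    unfolding sum_distrib_left using assms iff
    by (intro sum.mono_neutral_cong_left) auto
  finally show ?thesis .
qed

section \<open>Geometric sums and the fraction field\<close>

lemma monom_sum_multiples:
  assumes "e > 0"
  shows "(\<Sum>k<d * e. monom (if e dvd k then c else 0) k) = (\<Sum>i<d. monom c (i * e))"
proof -
  have "(\<Sum>k<d * e. monom (if e dvd k then c else 0) k) =
        (\<Sum>k | k < d * e \<and> e dvd k. monom c k)"
    by (intro sum.mono_neutral_cong_right) auto
  also have "\<dots> = (\<Sum>i<d. monom c (i * e))"
    by (rule sum.reindex_bij_witness[where i = "\<lambda>i. i * e" and j = "\<lambda>k. k div e"])
       (use assms in \<open>auto simp: less_mult_imp_div_less\<close>)
  finally show ?thesis .
qed

lemma to_fract_power: "to_fract (x ^ k) = to_fract x ^ k"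
  by (induction k) auto

lemma to_fract_monom: "to_fract (monom c k) = ratC c * ratX ^ k"
  by (simp add: ratC_def ratX_def monom_altdef flip: to_fract_power to_fract_mult)

lemma ratC_mult: "ratC (a * b) = ratC a * ratC b"
  by (simp add: ratC_def flip: to_fract_mult)

lemma ratC_divide: "b \<noteq> 0 \<Longrightarrow> ratC (a / b) = ratC a / ratC b"
  using ratC_mult[of "a / b" b] by (simp add: ratC_def eq_divide_eq)

text \<open>This makes the denominators 1 - x^(n/d) nonzero in the fraction field; degrees
  distinguish the two sides.\<close>

lemma ratX_power_neq_1:
  assumes "k > 0"
  shows "ratX ^ k \<noteq> 1"
proof
  assume "ratX ^ k = 1"
  hence "[:0, 1 :: real:] ^ k = 1"
    by (simp add: ratX_def flip: to_fract_power to_fract_1)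
  hence "degree ([:0, 1 :: real:] ^ k) = 0" by simp
  thus False using assms by (simp add: degree_power_eq)
qed

theorem theorem11:
  fixes n :: nat
  assumes "n \<ge> 1"
  shows "to_fract (T_poly n) =
    (1 - ratX ^ n) * ratC (real (totient n)) *
    (\<Sum>d | d dvd n.
       ratC (real_of_int ((moebius_mu d)\<^sup>2) * f_prod d (n div d)) /
       (ratC (real (totient d)) * (1 - ratX ^ (n div d))))"
proof -
  define c where "c = (\<lambda>d. (real_of_int (moebius_mu d))\<^sup>2 * f_prod d (n div d))"
  have "T_poly n = (\<Sum>k<n. \<Sum>d | d dvd n.
      monom (if n div d dvd k then totient n * (c d / totient d) else 0) k)"
    unfolding T_poly_def c_def using assms
    by (intro sum.cong) (simp_all add: norm_ramanujan_sum_eq_sum monom_sum)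
  also have "\<dots> = (\<Sum>d | d dvd n. \<Sum>k<n.
      monom (if n div d dvd k then totient n * (c d / totient d) else 0) k)"
    by (rule sum.swap)
  also have "\<dots> = (\<Sum>d | d dvd n. \<Sum>i<d. monom (totient n * (c d / totient d)) (i * (n div d)))"
  proof (rule sum.cong[OF refl])
    fix d assume "d \<in> {d. d dvd n}"
    thus "(\<Sum>k<n. monom (if n div d dvd k then totient n * (c d / totient d) else 0) k) =
          (\<Sum>i<d. monom (totient n * (c d / totient d)) (i * (n div d)))"
      using assms monom_sum_multiples[of "n div d" "totient n * (c d / totient d)" d]
      by (auto intro: Nat.gr0I simp: dvd_div_eq_0_iff)
  qed
  finally have "to_fract (T_poly n) =
      (\<Sum>d | d dvd n. \<Sum>i<d. to_fract (monom (totient n * (c d / totient d)) (i * (n div d))))"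
    by simp
  also have "\<dots> = (\<Sum>d | d dvd n. (1 - ratX ^ n) * ratC (totient n) *
      (ratC (c d) / (ratC (totient d) * (1 - ratX ^ (n div d)))))"
  proof (rule sum.cong[OF refl])
    fix d assume "d \<in> {d. d dvd n}"
    hence d: "d dvd n" "d > 0" "n div d > 0"
      using assms by (auto intro: Nat.gr0I simp: dvd_div_eq_0_iff)
    let ?y = "ratX ^ (n div d)"
    \<comment> \<open>These facts sum the \<open>d\<close> powers of \<open>?y\<close> to (1 - x^n)
      / (1 - x^(n/d)).\<close>
    have y: "?y \<noteq> 1" "?y ^ d = ratX ^ n"
      using d ratX_power_neq_1 by (auto simp flip: power_mult)
    have "(\<Sum>i<d. to_fract (monom (totient n * (c d / totient d)) (i * (n div d)))) =
          ratC (totient n * (c d / totient d)) * (\<Sum>i<d. ?y ^ i)"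
      unfolding sum_distrib_left
      by (intro sum.cong) (auto simp: to_fract_monom mult.commute simp flip: power_mult)
    also have "(\<Sum>i<d. ?y ^ i) = (1 - ratX ^ n) / (1 - ?y)"
      using y by (simp add: sum_gp_strict)
    also have "ratC (totient n * (c d / totient d)) = ratC (totient n) * (ratC (c d) / ratC (totient d))"
      using d by (simp add: ratC_mult ratC_divide)
    finally show "(\<Sum>i<d. to_fract (monom (totient n * (c d / totient d)) (i * (n div d)))) =
        (1 - ratX ^ n) * ratC (totient n) * (ratC (c d) / (ratC (totient d) * (1 - ?y)))"
      by simp
  qed
  finally show ?thesis by (simp add: c_def sum_distrib_left)
qed

end
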